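(* Let $n\geq 1$, $d\geq 2$, and let $F\in \mathrm{Sym}^d(\mathbb{C}^{n+1})$. Let $[L]\in\mathbb{P}(\mathrm{Sym}^1(\mathbb{C}^{n+1}))$. Then $[L]\in \mathrm{Eig}(F)$ if and only if there exists $\mu \in \mathbb{C}$ such that $L^{d-1}\in \mathrm{Ann}(F-\mu L^d)$. In particular, $\mu$ is the singular value of $L$ as an eigenvector of $F$.
   Context: Identify $\mathrm{Sym}^d(\mathbb{C}^{n+1})=\mathbb{C}[x_0,\dots,x_n]_d$. The apolar action is $G\circ F=G(\partial_0,\dots,\partial_n)F(x_0,\dots,x_n)$, where a polynomial $G$ in the $x_i$ acts via the substitution $x_i\mapsto\partial_i=\partial/\partial x_i$. The apolar ideal is $\mathrm{Ann}(F)=\{G\mid G\circ F=0\}$, where polynomials in the $x_i$ are regarded as elements via $x_i\mapsto\partial_i$. Let $\langle u,v\rangle_{\mathbb{C}}=\sum_iu_iv_i$ on $\mathbb{C}^{n+1}\cong\mathrm{Sym}^1(\mathbb{C}^{n+1})$ (variables orthonormal). The Bombieri-Weyl product on $\mathrm{Sym}^d(\mathbb{C}^{n+1})$ is the bilinear form determined by $\langle u^d,v^d\rangle=(\langle u,v\rangle_{\mathbb{C}})^d$. A nonzero linear form $L$ is an eigenvector of $F$ with singular value $\lambda\in\mathbb{C}$ if $\langle F-\lambda L^d,L^{d-1}M\rangle=0$ for every $M\in\mathrm{Sym}^1(\mathbb{C}^{n+1})$. (If $\langle L,L\rangle_{\mathbb{C}}=0$ the singular value is not unique.) $\mathrm{Eig}(F)$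 consists of all $[L]$ such that $L$ is an eigenvector of $F$. *)

theory Defs
  imports Complex_Main "HOL-Library.Poly_Mapping"
begin

(* Polynomials over the complex numbers in variables x_0, x_1, ...: a monomial is its
   finitely supported exponent vector, a polynomial the finitely supported family of its
   coefficients.  Multiplication is the convolution product of Poly_Mapping. *)
type_synonym cpoly = "(nat \<Rightarrow>\<^sub>0 nat) \<Rightarrow>\<^sub>0 complex"

definition const :: "complex \<Rightarrow> cpoly" where
  "const c = Poly_Mapping.single 0 c"

definition poly_ring :: "nat \<Rightarrow> cpoly set" where
  "poly_ring n = {G. \<forall>m\<in>Poly_Mapping.keys G. Poly_Mapping.keys m \<subseteq> {..n}}"

(* Sym^d(C^(n+1)) = C[x_0, ..., x_n]_d, including 0. *)
definition Sym :: "nat \<Rightarrow> nat \<Rightarrow> cpoly set" where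
  "Sym n d = {F \<in> poly_ring n.
     \<forall>m\<in>Poly_Mapping.keys F. (\<Sum>i\<in>Poly_Mapping.keys m. Poly_Mapping.lookup m i) = d}"

(* The subtraction of exponents truncates only where the coefficient
   lookup m i vanishes anyway. *)
definition partial :: "nat \<Rightarrow> cpoly \<Rightarrow> cpoly" where
  "partial i F = (\<Sum>m\<in>Poly_Mapping.keys F.
     Poly_Mapping.single (m - Poly_Mapping.single i 1)
       (of_nat (Poly_Mapping.lookup m i) * Poly_Mapping.lookup F m))"

definition partial_monom :: "(nat \<Rightarrow>\<^sub>0 nat) \<Rightarrow> cpoly \<Rightarrow> cpoly" where
  "partial_monom m F =
     foldr (\<lambda>i. partial i ^^ Poly_Mapping.lookup m i) (sorted_list_of_set (Poly_Mapping.keys m)) F"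

definition apolar :: "cpoly \<Rightarrow> cpoly \<Rightarrow> cpoly" where
  "apolar G F =
     (\<Sum>m\<in>Poly_Mapping.keys G. const (Poly_Mapping.lookup G m) * partial_monom m F)"

definition Ann :: "nat \<Rightarrow> cpoly \<Rightarrow> cpoly set" where
  "Ann n F = {G \<in> poly_ring n. apolar G F = 0}"

(* The bilinear (not Hermitian) form on linear forms for which x_0, ..., x_n are orthonormal. *)
definition lin_inner :: "nat \<Rightarrow> cpoly \<Rightarrow> cpoly \<Rightarrow> complex" where
  "lin_inner n u v =
     (\<Sum>i\<le>n. Poly_Mapping.lookup u (Poly_Mapping.single i 1) *
            Poly_Mapping.lookup v (Poly_Mapping.single i 1))"

definition bilinear_form_on :: "cpoly set \<Rightarrow> (cpoly \<Rightarrow> cpoly \<Rightarrow> complex) \<Rightarrow> bool" where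
  "bilinear_form_on V B \<longleftrightarrow>
     (\<forall>F\<in>V. \<forall>G\<in>V. \<forall>H\<in>V. B (F + G) H = B F H + B G H \<and> B H (F + G) = B H F + B H G) \<and>
     (\<forall>c. \<forall>F\<in>V. \<forall>G\<in>V. B (const c * F) G = c * B F G \<and> B F (const c * G) = c * B F G)"

definition bombieri_weyl_form :: "nat \<Rightarrow> nat \<Rightarrow> (cpoly \<Rightarrow> cpoly \<Rightarrow> complex) \<Rightarrow> bool" where
  "bombieri_weyl_form n d B \<longleftrightarrow>
     bilinear_form_on (Sym n d) B \<and>
     (\<forall>u\<in>Sym n 1. \<forall>v\<in>Sym n 1. B (u ^ d) (v ^ d) = lin_inner n u v ^ d)"

(* Such forms exist and agree on Sym n d, which is spanned by d-th powers of linear forms;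
   outside Sym n d they are arbitrary, so there the value below is meaningless. *)
definition bombieri_weyl :: "nat \<Rightarrow> nat \<Rightarrow> cpoly \<Rightarrow> cpoly \<Rightarrow> complex" where
  "bombieri_weyl n d F G = (THE c. \<exists>B. bombieri_weyl_form n d B \<and> B F G = c)"

definition eigenvector_with :: "nat \<Rightarrow> nat \<Rightarrow> cpoly \<Rightarrow> cpoly \<Rightarrow> complex \<Rightarrow> bool" where
  "eigenvector_with n d F L s \<longleftrightarrow>
     L \<in> Sym n 1 \<and> L \<noteq> 0 \<and>
     (\<forall>M\<in>Sym n 1. bombieri_weyl n d (F - const s * L ^ d) (L ^ (d - 1) * M) = 0)"

(* The point [L] of the projective space of Sym^1, as the set of its representatives. *)
definition proj_point :: "cpoly \<Rightarrow> cpoly set" where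
  "proj_point L = {const c * L | c. c \<noteq> 0}"

definition Eig :: "nat \<Rightarrow> nat \<Rightarrow> cpoly \<Rightarrow> cpoly set set" where
  "Eig n d F = {proj_point L | L. \<exists>s. eigenvector_with n d F L s}"

end

theory Submission
  imports Defs
begin

text \<open>
  The apolar action decides everything because it computes the Bombieri-Weyl product: on forms
  of degree \<open>d\<close>, \<open>\<langle>F, G\<rangle>\<close> is the constant \<open>G \<circ> F\<close> divided by \<open>d!\<close>.

  To see this, a linear form \<open>v\<close> acts as the derivation \<open>\<Sum>\<^sub>i v\<^sub>i \<partial>\<^sub>i\<close>, which sends \<open>u^k\<close> to
  \<open>k \<langle>u, v\<rangle> u^(k-1)\<close>; iterating, \<open>v^d \<circ> u^d = d! \<langle>u, v\<rangle>^d\<close> (lemma \<open>apolar_power_power\<close>).  So the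
  normalised apolar pairing has the values on powers that define the product.  Two bilinear forms
  with these values agree, because powers of linear forms span the forms of degree \<open>d\<close>; the span is
  used in its dual version, that a linear functional vanishing on all powers is zero
  (lemma \<open>linear_functional_zero_if_zero_on_powers\<close>).

  Now let \<open>G = F - s L^d\<close>.  Because the action is one of the commutative polynomial ring,
  \<open>d! \<langle>G, L^(d-1) M\<rangle> = M \<circ> (L^(d-1) \<circ> G)\<close>, and \<open>L^(d-1) \<circ> G\<close> is a linear form.  A linear form
  is zero exactly if every linear \<open>M\<close> kills it, so \<open>L\<close> is an eigenvector with singular value \<open>s\<close>
  if and only if \<open>L^(d-1) \<circ> G = 0\<close> (lemma \<open>eigenvector_with_iff\<close>).

  An eigenpoint may be represented by a multiple \<open>c L\<close> whose singular value is \<open>s\<close>; this becomes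
  \<open>\<mu> = s c^d\<close> for \<open>L\<close>.  For \<open>\<langle>L, L\<rangle> \<noteq> 0\<close> the choice \<open>M = L\<close> gives \<open>\<langle>F, L^d\<rangle> = s \<langle>L, L\<rangle>^d\<close>, which
  determines \<open>s\<close>.
\<close>

section \<open>Finitely supported coefficient families\<close>

abbreviation (input) "lookup \<equiv> Poly_Mapping.lookup"
abbreviation (input) "single \<equiv> Poly_Mapping.single"
abbreviation (input) "keys \<equiv> Poly_Mapping.keys"

lemma sum_single_keys: "(\<Sum>m\<in>keys p. single m (lookup p m)) = p"
  by (rule poly_mapping_eqI)
    (auto simp: lookup_sum lookup_single when_def in_keys_iff)

lemma poly_mapping_single_induct [case_names single add]:
  fixes p :: "'a \<Rightarrow>\<^sub>0 'b::comm_monoid_add"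
  assumes "\<And>m c. P (single m c)" and "\<And>p q. P p \<Longrightarrow> P q \<Longrightarrow> P (p + q)"
  shows "P p"
proof -
  have zero: "P 0"
    using assms(1)[of _ 0] by simp
  have "P (\<Sum>m\<in>A. single m (lookup p m))" if "finite A" for A
    using that by (induction A) (auto intro: zero assms)
  then have "P (\<Sum>m\<in>keys p. single m (lookup p m))"
    by simp
  then show ?thesis
    by (simp add: sum_single_keys)
qed

lemma lookup_const_times [simp]: "lookup (const c * F) m = c * lookup F m"
proof -
  have "const c * F = Poly_Mapping.map ((*) c) F"
    by (simp add: const_def mult_map_scale_conv_mult)
  then show ?thesis
    by (simp add: Poly_Mapping.map.rep_eq when_def)
qed

lemma const_0 [simp]: "const 0 = 0" and const_1 [simp]: "const 1 = 1"
  by (simp_all add: const_def)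

lemma lookup_const_0 [simp]: "lookup (const c) 0 = c"
  by (simp add: const_def)

lemma const_eq_0_iff [simp]: "const c = 0 \<longleftrightarrow> c = 0"
  by (metis const_0 lookup_const_0 lookup_zero)

lemma const_add: "const (a + b) = const a + const b"
  by (simp add: const_def single_add)

lemma const_mult: "const (a * b) = const a * const b"
  by (simp add: const_def mult_single)

lemma const_power: "const (a ^ k) = const a ^ k"
  by (induction k) (simp_all add: const_mult)

section \<open>Partial derivatives\<close>

lemma lookup_partial:
  "lookup (partial i F) k = of_nat (Suc (lookup k i)) * lookup F (k + single i 1)"
proof -
  have eq: "m - single i 1 = k \<longleftrightarrow> m = k + single i 1" if "lookup m i \<noteq> 0" for m :: "nat \<Rightarrow>\<^sub>0 nat"
  proof
    assume k: "m - single i 1 = k"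
    have "m = (m - single i 1) + single i 1"
      using that by (intro poly_mapping_eqI)
        (auto simp: lookup_add minus_poly_mapping.rep_eq lookup_single when_def)
    with k show "m = k + single i 1" by simp
  qed simp
  have "lookup (partial i F) k
      = (\<Sum>m\<in>keys F. (of_nat (lookup m i) * lookup F m when m - single i 1 = k))"
    by (simp add: partial_def lookup_sum lookup_single)
  also have "\<dots> = (\<Sum>m\<in>keys F. if m = k + single i 1 then of_nat (lookup m i) * lookup F m else 0)"
    by (rule sum.cong [OF refl]) (use eq in \<open>auto simp: when_def\<close>)
  also have "\<dots> = of_nat (Suc (lookup k i)) * lookup F (k + single i 1)"
    by (simp add: lookup_add in_keys_iff)
  finally show ?thesis .
qed

lemma partial_add: "partial i (F + G) = partial i F + partial i G"
  by (rule poly_mapping_eqI) (simp add: lookup_partial lookup_add algebra_simps)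

lemma partial_sum: "partial i (sum f A) = (\<Sum>x\<in>A. partial i (f x))"
  by (rule poly_mapping_eqI) (simp add: lookup_partial lookup_sum sum_distrib_left)

lemma partial_single:
  "partial i (single m c) = single (m - single i 1) (of_nat (lookup m i) * c)"
  by (cases "c = 0") (simp_all add: partial_def)

lemma partial_mult: "partial i (F * G) = partial i F * G + F * partial i G"
proof (induction F rule: poly_mapping_single_induct)
  case (single m c)
  show ?case
  proof (induction G rule: poly_mapping_single_induct)
    case (single m' c')
    have 1: "(m - single i 1) + m' = m + m' - single i 1" if "lookup m i \<noteq> 0"
      using that by (intro poly_mapping_eqI)
        (auto simp: lookup_add minus_poly_mapping.rep_eq lookup_single when_def)
    have 2: "m + (m' - single i 1) = m + m' - single i 1" if "lookup m' i \<noteq> 0"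
      using that by (intro poly_mapping_eqI)
        (auto simp: lookup_add minus_poly_mapping.rep_eq lookup_single when_def)
    have "partial i (single m c) * single m' c'
        = single (m + m' - single i 1) (of_nat (lookup m i) * c * c')"
      using 1 by (cases "lookup m i = 0") (simp_all add: partial_single mult_single)
    moreover have "single m c * partial i (single m' c')
        = single (m + m' - single i 1) (of_nat (lookup m' i) * c * c')"
      using 2 by (cases "lookup m' i = 0") (simp_all add: partial_single mult_single mult_ac)
    ultimately show ?case
      by (simp add: mult_single partial_single lookup_add single_add [symmetric] algebra_simps)
  qed (simp add: partial_add algebra_simps)
qed (simp add: partial_add algebra_simps)

section \<open>The apolar action\<close>

text \<open>The factorial \<open>m! = \<Prod>\<^sub>i m\<^sub>i!\<close> of a multi-index, taken in the complex numbers because only its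
  quotients matter below.\<close>

definition multi_fact :: "(nat \<Rightarrow>\<^sub>0 nat) \<Rightarrow> complex" where
  "multi_fact m = (\<Prod>i\<in>keys m. fact (lookup m i))"

lemma multi_fact_nonzero [simp]: "multi_fact m \<noteq> 0"
  by (simp add: multi_fact_def)

lemma multi_fact_superset:
  "finite S \<Longrightarrow> keys m \<subseteq> S \<Longrightarrow> multi_fact m = (\<Prod>i\<in>S. fact (lookup m i))"
  unfolding multi_fact_def by (rule prod.mono_neutral_left) (auto simp: in_keys_iff)

lemma multi_fact_add_single_1: "multi_fact (m + single i 1) = of_nat (Suc (lookup m i)) * multi_fact m"
proof -
  let ?S = "insert i (keys m)"
  have "multi_fact (m + single i 1) = (\<Prod>j\<in>?S. fact (lookup (m + single i 1) j))"
    by (rule multi_fact_superset) (auto simp: in_keys_iff lookup_add lookup_single when_def split: if_splits)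
  also have "\<dots> = fact (Suc (lookup m i)) * (\<Prod>j\<in>?S - {i}. fact (lookup m j))"
    by (subst prod.remove[of _ i]) (auto simp: lookup_add lookup_single when_def intro!: prod.cong)
  also have "\<dots> = of_nat (Suc (lookup m i)) * (fact (lookup m i) * (\<Prod>j\<in>?S - {i}. fact (lookup m j)))"
    by simp
  also have "fact (lookup m i) * (\<Prod>j\<in>?S - {i}. fact (lookup m j)) = (\<Prod>j\<in>?S. fact (lookup m j) :: complex)"
    by (rule prod.remove [symmetric]) auto
  also have "\<dots> = multi_fact m"
    by (rule multi_fact_superset [symmetric]) auto
  finally show ?thesis .
qed

lemma lookup_partial_funpow:
  "lookup ((partial i ^^ a) F) k = multi_fact (k + single i a) / multi_fact k * lookup F (k + single i a)"
proof (induction a arbitrary: k)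
  case (Suc a)
  have "k + single i 1 + single i a = k + single i (Suc a)"
    by (simp add: add.assoc single_add [symmetric])
  then show ?case
    by (simp add: lookup_partial Suc multi_fact_add_single_1 [unfolded One_nat_def] del: of_nat_Suc)
qed simp

text \<open>The order of differentiation in the definition becomes invisible in this closed form: the
  quotients of factorials telescope along the list of variables.  Composition and linearity in \<open>F\<close>
  are read off from it.\<close>

lemma lookup_partial_monom:
  "lookup (partial_monom m F) k = multi_fact (k + m) / multi_fact k * lookup F (k + m)"
proof -
  have "lookup (foldr (\<lambda>i. partial i ^^ lookup m i) xs F) k
      = multi_fact (k + (\<Sum>i\<leftarrow>xs. single i (lookup m i))) / multi_fact k
        * lookup F (k + (\<Sum>i\<leftarrow>xs. single i (lookup m i)))" for xs
    by (induction xs arbitrary: k) (simp_all add: lookup_partial_funpow add.assoc)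
  moreover have "(\<Sum>i\<leftarrow>sorted_list_of_set (keys m). single i (lookup m i)) = m"
    by (simp add: sum_list_distinct_conv_sum_set sum_single_keys)
  ultimately show ?thesis
    by (simp add: partial_monom_def)
qed

lemma lookup_apolar:
  "lookup (apolar G F) k
     = (\<Sum>m\<in>keys G. lookup G m * (multi_fact (k + m) / multi_fact k * lookup F (k + m)))"
  by (simp add: apolar_def lookup_sum lookup_partial_monom)

lemma apolar_single: "apolar (single m c) F = const c * partial_monom m F"
  by (cases "c = 0") (simp_all add: apolar_def)

lemma apolar_add_left: "apolar (G + H) F = apolar G F + apolar H F"
  unfolding apolar_def
  by (rule setsum_keys_plus_distrib) (simp_all add: const_def single_add algebra_simps)

lemma apolar_0_left [simp]: "apolar 0 F = 0"
  by (simp add: apolar_def)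

lemma apolar_sum_left: "apolar (sum f A) F = (\<Sum>x\<in>A. apolar (f x) F)"
  by (induction A rule: infinite_finite_induct) (simp_all add: apolar_add_left)

lemma apolar_add_right: "apolar G (E + F) = apolar G E + apolar G F"
  by (rule poly_mapping_eqI) (simp add: lookup_apolar lookup_add algebra_simps sum.distrib)

lemma apolar_scale_right: "apolar G (const c * F) = const c * apolar G F"
  by (rule poly_mapping_eqI) (simp add: lookup_apolar sum_distrib_left mult.left_commute)

text \<open>The apolar action makes the polynomials a module over the polynomial ring.  On monomials this is
  the telescoping \<open>(k+m+m')!/(k+m)! \<cdot> (k+m)!/k! = (k+m+m')!/k!\<close>.\<close>

lemma apolar_mult: "apolar (G * H) F = apolar G (apolar H F)"
proof (induction G rule: poly_mapping_single_induct)
  case (single m c)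
  show ?case
  proof (induction H rule: poly_mapping_single_induct)
    case (single m' c')
    show ?case
      by (rule poly_mapping_eqI)
        (simp add: mult_single apolar_single lookup_partial_monom add.assoc)
  qed (simp add: algebra_simps apolar_add_left apolar_add_right)
qed (simp add: algebra_simps apolar_add_left)

lemma apolar_const: "apolar (const c) F = const c * F"
  by (simp add: const_def apolar_single [of 0 c, unfolded const_def] partial_monom_def)

lemma apolar_scale_left: "apolar (const c * G) F = const c * apolar G F"
  by (simp add: apolar_mult apolar_const)

section \<open>Forms of fixed degree\<close>

definition mdeg :: "(nat \<Rightarrow>\<^sub>0 nat) \<Rightarrow> nat" where
  "mdeg m = (\<Sum>i\<in>keys m. lookup m i)"

lemma mdeg_single [simp]: "mdeg (single i a) = a"
  by (cases "a = 0") (simp_all add: mdeg_def)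

lemma mdeg_add: "mdeg (m + m') = mdeg m + mdeg m'"
  unfolding mdeg_def by (rule setsum_keys_plus_distrib) simp_all

lemma keys_add_nat: "keys (m + m') = keys m \<union> keys (m' :: nat \<Rightarrow>\<^sub>0 nat)"
  by (auto simp: in_keys_iff lookup_add)

lemma Sym_iff: "F \<in> Sym n d \<longleftrightarrow> (\<forall>m\<in>keys F. keys m \<subseteq> {..n} \<and> mdeg m = d)"
  by (auto simp: Sym_def poly_ring_def mdeg_def)

lemma Sym_subset_poly_ring: "F \<in> Sym n d \<Longrightarrow> F \<in> poly_ring n"
  by (simp add: Sym_def)

lemma Sym_zero [simp]: "0 \<in> Sym n d"
  by (simp add: Sym_iff)

lemma Sym_add [intro]: "F \<in> Sym n d \<Longrightarrow> G \<in> Sym n d \<Longrightarrow> F + G \<in> Sym n d"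
  using keys_add [of F G] by (auto simp: Sym_iff)

lemma Sym_scale [intro]: "F \<in> Sym n d \<Longrightarrow> const c * F \<in> Sym n d"
  by (auto simp: Sym_iff in_keys_iff)

lemma Sym_diff [intro]: "F \<in> Sym n d \<Longrightarrow> G \<in> Sym n d \<Longrightarrow> F - G \<in> Sym n d"
  using keys_diff [of F G] by (auto simp: Sym_iff)

lemma Sym_sum: "(\<And>x. x \<in> A \<Longrightarrow> f x \<in> Sym n d) \<Longrightarrow> sum f A \<in> Sym n d"
  by (induction A rule: infinite_finite_induct) auto

lemma Sym_single: "keys m \<subseteq> {..n} \<Longrightarrow> mdeg m = d \<Longrightarrow> single m c \<in> Sym n d"
  by (auto simp: Sym_iff split: if_splits)

lemma Sym_mult: "F \<in> Sym n a \<Longrightarrow> G \<in> Sym n b \<Longrightarrow> F * G \<in> Sym n (a + b)"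
  using keys_mult [of F G] by (fastforce simp: Sym_iff mdeg_add keys_add_nat)

lemma Sym_power: "u \<in> Sym n 1 \<Longrightarrow> u ^ k \<in> Sym n k"
proof (induction k)
  case 0
  then show ?case by (simp add: Sym_iff mdeg_def)
next
  case (Suc k)
  then show ?case using Sym_mult [of u n 1 "u ^ k" k] by simp
qed

lemma apolar_in_Sym:
  assumes "G \<in> Sym n a" and "F \<in> Sym n (a + b)"
  shows "apolar G F \<in> Sym n b"
  unfolding Sym_iff
proof
  fix k assume "k \<in> keys (apolar G F)"
  then have "(\<Sum>m\<in>keys G. lookup G m * (multi_fact (k + m) / multi_fact k * lookup F (k + m))) \<noteq> 0"
    unfolding in_keys_iff lookup_apolar .
  then obtain m where "m \<in> keys G"
      "lookup G m * (multi_fact (k + m) / multi_fact k * lookup F (k + m)) \<noteq> 0"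
    by (rule sum.not_neutral_contains_not_neutral)
  then have m: "m \<in> keys G" "lookup F (k + m) \<noteq> 0"
    by simp_all
  then have "k + m \<in> keys F" by (simp add: in_keys_iff)
  then show "keys k \<subseteq> {..n} \<and> mdeg k = b"
    using assms m(1) by (fastforce simp: Sym_iff mdeg_add keys_add_nat)
qed

lemma mdeg_0 [simp]: "mdeg 0 = 0"
  by (simp add: mdeg_def)

lemma mdeg_eq_0_iff [simp]: "mdeg m = 0 \<longleftrightarrow> m = 0"
  by (auto simp: mdeg_def in_keys_iff intro!: poly_mapping_eqI)

lemma mdeg_Suc_decomp:
  assumes "mdeg m = Suc j"
  obtains i m' where "m = m' + single i 1" "mdeg m' = j"
proof -
  obtain i where "i \<in> keys m"
    using assms by (fastforce simp: mdeg_def)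
  then have eq: "m = (m - single i 1) + single i 1"
    by (intro poly_mapping_eqI)
        (auto simp: lookup_add minus_poly_mapping.rep_eq lookup_single when_def in_keys_iff)
  then have "Suc j = mdeg (m - single i 1) + 1"
    using assms by (metis mdeg_add mdeg_single)
  then show thesis using eq that by simp
qed

lemma mdeg_1_cases:
  assumes "mdeg m = 1"
  obtains i where "m = single i 1"
  using assms mdeg_Suc_decomp [of m 0] by (metis One_nat_def add_0 mdeg_eq_0_iff)

section \<open>Linear forms act as derivations\<close>

lemma linear_form_expand:
  assumes "u \<in> Sym n 1"
  shows "u = (\<Sum>i\<le>n. single (single i 1) (lookup u (single i 1)))"
proof (rule poly_mapping_eqI)
  fix m
  have "lookup (\<Sum>i\<le>n. single (single i 1) (lookup u (single i 1))) m
     = (\<Sum>i\<le>n. if single i 1 = m then lookup u m else 0)"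
    by (auto simp: lookup_sum lookup_single when_def intro!: sum.cong)
  also have "\<dots> = lookup u m"
  proof (cases "m \<in> keys u")
    case True
    then obtain j where j: "m = single j 1" "j \<le> n"
      using assms by (metis Sym_iff atMost_iff insert_subset keys_single mdeg_1_cases one_neq_zero)
    have "single i 1 = m \<longleftrightarrow> i = j" for i
      unfolding j by (metis j(1) keys_single one_neq_zero singleton_inject)
    then show ?thesis using j by simp
  qed (simp add: in_keys_iff sum.neutral)
  finally show "lookup u m = lookup (\<Sum>i\<le>n. single (single i 1) (lookup u (single i 1))) m"
    by simp
qed

lemma partial_monom_single [simp]: "partial_monom (single i (Suc 0)) F = partial i F"
  by (simp add: partial_monom_def)

lemma apolar_linear_form:
  assumes "u \<in> Sym n 1"
  shows "apolar u F = (\<Sum>i\<le>n. const (lookup u (single i 1)) * partial i F)"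
  by (subst linear_form_expand [OF assms]) (simp add: apolar_sum_left apolar_single)

lemma partial_linear_form:
  assumes "u \<in> Sym n 1" "i \<le> n"
  shows "partial i u = const (lookup u (single i 1))"
proof -
  have "partial i u = (\<Sum>j\<le>n. if j = i then const (lookup u (single i 1)) else 0)"
    by (subst linear_form_expand [OF assms(1)], unfold partial_sum, rule sum.cong [OF refl])
      (simp add: partial_single lookup_single const_def when_def)
  then show ?thesis using assms(2) by simp
qed

lemma apolar_linear_mult:
  assumes "v \<in> Sym n 1"
  shows "apolar v (F * G) = apolar v F * G + F * apolar v G"
  unfolding apolar_linear_form [OF assms]
  by (simp add: partial_mult algebra_simps sum.distrib sum_distrib_left)

lemma const_sum: "const (sum f A) = (\<Sum>x\<in>A. const (f x))"
  by (induction A rule: infinite_finite_induct) (simp_all add: const_add)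

lemma apolar_linear_linear:
  assumes "v \<in> Sym n 1" "u \<in> Sym n 1"
  shows "apolar v u = const (lin_inner n u v)"
  unfolding apolar_linear_form [OF assms(1)]
  by (simp add: partial_linear_form [OF assms(2)] lin_inner_def const_sum const_mult mult.commute)

lemma apolar_linear_power:
  assumes "v \<in> Sym n 1" "u \<in> Sym n 1"
  shows "apolar v (u ^ Suc k) = const (of_nat (Suc k) * lin_inner n u v) * u ^ k"
proof (induction k)
  case 0
  then show ?case by (simp add: apolar_linear_linear [OF assms])
next
  case (Suc k)
  have "apolar v (u ^ Suc (Suc k)) = apolar v u * u ^ Suc k + u * apolar v (u ^ Suc k)"
    using apolar_linear_mult [OF assms(1), of u "u ^ Suc k"] by simp
  also have "\<dots> = const (of_nat (Suc (Suc k)) * lin_inner n u v) * u ^ Suc k"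
  proof -
    have "const (of_nat (Suc (Suc k)) * c) = const c + const (of_nat (Suc k) * c)" for c
      by (simp add: const_add [symmetric] algebra_simps)
    then show ?thesis
      unfolding Suc by (simp add: apolar_linear_linear [OF assms] algebra_simps del: of_nat_Suc)
  qed
  finally show ?case .
qed

text \<open>Each of the \<open>k\<close> factors \<open>v\<close> lowers the power of \<open>u\<close> by one and contributes \<open>\<langle>u, v\<rangle>\<close>; the
  exponents met on the way multiply to \<open>k!\<close>.\<close>

lemma apolar_power_power:
  assumes "v \<in> Sym n 1" "u \<in> Sym n 1"
  shows "apolar (v ^ k) (u ^ k) = const (fact k * lin_inner n u v ^ k)"
proof (induction k)
  case 0
  then show ?case using apolar_const [of 1 1] by simp
next
  case (Suc k)
  have "apolar (v ^ Suc k) (u ^ Suc k) = apolar (v ^ k) (apolar v (u ^ Suc k))"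
    by (simp only: power_Suc2 apolar_mult)
  also have "\<dots> = const (of_nat (Suc k) * lin_inner n u v) * const (fact k * lin_inner n u v ^ k)"
    by (simp only: apolar_linear_power [OF assms] apolar_scale_right Suc)
  also have "\<dots> = const (fact (Suc k) * lin_inner n u v ^ Suc k)"
    by (simp add: const_mult [symmetric] mult_ac)
  finally show ?case .
qed


section \<open>Powers of linear forms determine linear functionals\<close>

lemma of_nat_const: "of_nat k = const (of_nat k)"
  by (simp add: const_def)

text \<open>The powers span, by polarization.  Instead of an explicit polarization formula, the proof
  trades the factors of a power \<open>u^d\<close> for variables one at a time: as \<open>\<phi>\<close> vanishes on
  \<open>(t v + u)^(k+1) s\<close> for every number \<open>t\<close>, all coefficients of this polynomial in \<open>t\<close> vanish, and
  that of \<open>t\<close> itself is \<open>(k+1) \<phi>(v u^k s)\<close>.\<close>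

lemma linear_functional_zero_if_zero_on_powers:
  fixes \<phi> :: "cpoly \<Rightarrow> complex"
  assumes add: "\<And>F G. F \<in> Sym n d \<Longrightarrow> G \<in> Sym n d \<Longrightarrow> \<phi> (F + G) = \<phi> F + \<phi> G"
    and scale: "\<And>c F. F \<in> Sym n d \<Longrightarrow> \<phi> (const c * F) = c * \<phi> F"
    and pow: "\<And>u. u \<in> Sym n 1 \<Longrightarrow> \<phi> (u ^ d) = 0"
    and F: "F \<in> Sym n d"
  shows "\<phi> F = 0"
proof -
  have zero: "\<phi> 0 = 0"
    using scale [of 0 0] by simp
  have sum: "\<phi> (sum f A) = (\<Sum>x\<in>A. \<phi> (f x))"
    if "\<And>x. x \<in> A \<Longrightarrow> f x \<in> Sym n d" for f :: "'a \<Rightarrow> cpoly" and A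
    using that by (induction A rule: infinite_finite_induct) (simp_all add: zero add Sym_sum)
  have mixed: "\<phi> (u ^ k * single m 1) = 0"
    if "u \<in> Sym n 1" "keys m \<subseteq> {..n}" "k + mdeg m = d" for u k m
    using that
  proof (induction "mdeg m" arbitrary: u k m)
    case 0
    then have "m = 0" by simp
    with 0 pow show ?case by simp
  next
    case (Suc j)
    obtain i m' where m: "m = m' + single i 1" "mdeg m' = j"
      using Suc.hyps(2) by (metis mdeg_Suc_decomp)
    have i: "i \<le> n" and m'_sub: "keys m' \<subseteq> {..n}"
      using Suc.prems(2) by (auto simp: m(1) keys_add_nat)
    define v :: cpoly where "v = single (single i 1) 1"
    define s :: cpoly where "s = single m' 1"
    have v: "v \<in> Sym n 1" and s: "s \<in> Sym n j"
      using i m m'_sub by (auto simp: v_def s_def intro!: Sym_single)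
    have vs: "single m 1 = v * s"
      by (simp add: m(1) v_def s_def mult_single add.commute)
    have term_in: "v ^ l * u ^ (Suc k - l) * s \<in> Sym n d" if "l \<le> Suc k" for l
    proof -
      have "v ^ l * u ^ (Suc k - l) * s \<in> Sym n (l + (Suc k - l) + j)"
        by (intro Sym_mult Sym_power v s Suc.prems)
      moreover have "l + (Suc k - l) + j = d"
        using that Suc.hyps(2) Suc.prems(3) by linarith
      ultimately show ?thesis by simp
    qed
    have "(\<Sum>l\<le>Suc k. (of_nat (Suc k choose l) * \<phi> (v ^ l * u ^ (Suc k - l) * s)) * t ^ l) = 0" for t
    proof -
      have "(\<Sum>l\<le>Suc k. (of_nat (Suc k choose l) * \<phi> (v ^ l * u ^ (Suc k - l) * s)) * t ^ l)
          = (\<Sum>l\<le>Suc k. \<phi> (const (of_nat (Suc k choose l) * t ^ l) * (v ^ l * u ^ (Suc k - l) * s)))"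
        by (rule sum.cong [OF refl]) (simp add: scale term_in)
      also have "\<dots> = \<phi> (\<Sum>l\<le>Suc k. const (of_nat (Suc k choose l) * t ^ l) * (v ^ l * u ^ (Suc k - l) * s))"
        by (rule sum [symmetric]) (simp add: Sym_scale term_in)
      also have "(\<Sum>l\<le>Suc k. const (of_nat (Suc k choose l) * t ^ l) * (v ^ l * u ^ (Suc k - l) * s))
          = (const t * v + u) ^ Suc k * s"
        unfolding binomial_ring sum_distrib_right
        by (rule sum.cong [OF refl])
          (simp add: const_mult const_power power_mult_distrib mult_ac of_nat_const [symmetric])
      also have "\<phi> ((const t * v + u) ^ Suc k * s) = 0"
        unfolding s_def using Suc.prems Suc.hyps(2) m v m'_sub
        by (intro Suc.hyps(1)) auto
      finally show ?thesis .
    qed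
    then have "\<forall>l\<le>Suc k. of_nat (Suc k choose l) * \<phi> (v ^ l * u ^ (Suc k - l) * s) = 0"
      by (subst polyfun_eq_0 [symmetric]) blast
    \<comment> \<open>The coefficient of \<open>t\<close> is the one in which exactly one factor \<open>u\<close> is replaced by \<open>v\<close>.\<close>
    from this [rule_format, of 1] have "\<phi> (v * u ^ k * s) = 0"
      by (simp del: of_nat_Suc)
    then show ?case by (simp add: vs mult_ac)
  qed
  have mono: "\<phi> (single m c) = 0" and mono_in: "single m c \<in> Sym n d" if "m \<in> keys F" for m c
  proof -
    have m: "keys m \<subseteq> {..n}" "mdeg m = d" using F that by (auto simp: Sym_iff)
    then show "single m c \<in> Sym n d" by (rule Sym_single)
    \<comment> \<open>The case of \<open>mixed\<close> in which all \<open>d\<close> factors are variables.\<close>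
    have "\<phi> (const c * single m 1) = c * \<phi> (0 ^ 0 * single m 1)"
      using scale [OF Sym_single, OF m] by simp
    also have "\<dots> = 0"
      using mixed [of 0 m 0] m by simp
    finally show "\<phi> (single m c) = 0"
      by (simp add: const_def mult_single)
  qed
  have "\<phi> (\<Sum>m\<in>keys F. single m (lookup F m)) = 0"
    by (subst sum) (simp_all add: mono mono_in)
  then show ?thesis by (simp add: sum_single_keys)
qed

section \<open>The Bombieri-Weyl product as an apolar pairing\<close>

definition apolar_form :: "nat \<Rightarrow> cpoly \<Rightarrow> cpoly \<Rightarrow> complex" where
  "apolar_form d F G = lookup (apolar G F) 0 / fact d"

lemma apolar_form_powers:
  assumes "u \<in> Sym n 1" "v \<in> Sym n 1"
  shows "apolar_form d (u ^ d) (v ^ d) = lin_inner n u v ^ d"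
  by (simp add: apolar_form_def apolar_power_power [OF assms(2,1)])

lemma apolar_form_add:
  "apolar_form d (F + G) H = apolar_form d F H + apolar_form d G H"
  "apolar_form d H (F + G) = apolar_form d H F + apolar_form d H G"
  by (simp_all add: apolar_form_def apolar_add_left apolar_add_right lookup_add add_divide_distrib)

lemma apolar_form_scale:
  "apolar_form d (const c * F) H = c * apolar_form d F H"
  "apolar_form d H (const c * F) = c * apolar_form d H F"
  by (simp_all add: apolar_form_def apolar_scale_left apolar_scale_right)

lemma bombieri_weyl_form_apolar_form: "bombieri_weyl_form n d (apolar_form d)"
  by (simp add: bombieri_weyl_form_def bilinear_form_on_def apolar_form_powers
      apolar_form_add apolar_form_scale)

text \<open>The difference of two such forms is a linear functional in each argument; fixing a power on the
  right shows that it vanishes for all left arguments, and then fixing any left argument shows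
  that it vanishes for all right arguments.\<close>

lemma bombieri_weyl_form_unique:
  assumes B: "bombieri_weyl_form n d B" and B': "bombieri_weyl_form n d B'"
    and "F \<in> Sym n d" "G \<in> Sym n d"
  shows "B F G = B' F G"
proof -
  have bil: "bilinear_form_on (Sym n d) B" "bilinear_form_on (Sym n d) B'"
    and pow: "\<And>u v. u \<in> Sym n 1 \<Longrightarrow> v \<in> Sym n 1 \<Longrightarrow> B (u ^ d) (v ^ d) = B' (u ^ d) (v ^ d)"
    using B B' by (auto simp: bombieri_weyl_form_def)
  have lin: "C (F + G) H = C F H + C G H" "C H (F + G) = C H F + C H G"
      "C (const c * F) H = c * C F H" "C H (const c * F) = c * C H F"
    if "bilinear_form_on (Sym n d) C" "F \<in> Sym n d" "G \<in> Sym n d" "H \<in> Sym n d" for C F G H c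
    using that unfolding bilinear_form_on_def by blast+
  have left: "B F (v ^ d) - B' F (v ^ d) = 0" if F: "F \<in> Sym n d" and v: "v \<in> Sym n 1" for F v
  proof (rule linear_functional_zero_if_zero_on_powers [where \<phi> = "\<lambda>F. B F (v ^ d) - B' F (v ^ d)", OF _ _ _ F])
    note vd = Sym_power [OF v, of d]
    show "B (F + G) (v ^ d) - B' (F + G) (v ^ d)
        = (B F (v ^ d) - B' F (v ^ d)) + (B G (v ^ d) - B' G (v ^ d))"
      if "F \<in> Sym n d" "G \<in> Sym n d" for F G
      by (simp add: lin(1) [OF bil(1) that vd] lin(1) [OF bil(2) that vd])
    show "B (const c * F) (v ^ d) - B' (const c * F) (v ^ d) = c * (B F (v ^ d) - B' F (v ^ d))"
      if "F \<in> Sym n d" for c F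
      by (simp add: lin(3) [OF bil(1) that that vd] lin(3) [OF bil(2) that that vd] right_diff_distrib)
    show "B (u ^ d) (v ^ d) - B' (u ^ d) (v ^ d) = 0" if "u \<in> Sym n 1" for u
      using pow [OF that v] by simp
  qed
  have "B F G - B' F G = 0"
  proof (rule linear_functional_zero_if_zero_on_powers [where \<phi> = "\<lambda>G. B F G - B' F G", OF _ _ _ assms(4)])
    note F = assms(3)
    show "B F (G + H) - B' F (G + H) = (B F G - B' F G) + (B F H - B' F H)"
      if "G \<in> Sym n d" "H \<in> Sym n d" for G H
      by (simp add: lin(2) [OF bil(1) that F] lin(2) [OF bil(2) that F])
    show "B F (const c * G) - B' F (const c * G) = c * (B F G - B' F G)" if "G \<in> Sym n d" for c G
      by (simp add: lin(4) [OF bil(1) that that F] lin(4) [OF bil(2) that that F] right_diff_distrib)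
    show "B F (v ^ d) - B' F (v ^ d) = 0" if "v \<in> Sym n 1" for v
      using left [OF F that] .
  qed
  then show ?thesis by simp
qed

text \<open>Existence and uniqueness together make the definite description meaningful.\<close>

lemma bombieri_weyl_eq:
  assumes "F \<in> Sym n d" "G \<in> Sym n d"
  shows "bombieri_weyl n d F G = apolar_form d F G"
  unfolding bombieri_weyl_def
  using bombieri_weyl_form_apolar_form bombieri_weyl_form_unique [OF _ _ assms]
  by (intro the_equality) blast+

section \<open>Eigenvectors\<close>

text \<open>Nondegeneracy of the pairing in degree one: the variable \<open>x\<^sub>i\<close> extracts the \<open>i\<close>-th
  coefficient.\<close>

lemma linear_form_zero_iff:
  assumes "A \<in> Sym n 1"
  shows "A = 0 \<longleftrightarrow> (\<forall>M\<in>Sym n 1. lookup (apolar M A) 0 = 0)"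
proof
  assume *: "\<forall>M\<in>Sym n 1. lookup (apolar M A) 0 = 0"
  have "lookup A (single i 1) = 0" if "i \<le> n" for i
  proof -
    have "single (single i 1) 1 \<in> Sym n 1"
      using that by (intro Sym_single) auto
    with * have "lookup (apolar (single (single i 1) 1) A) 0 = 0" by blast
    then show ?thesis
      by (simp add: apolar_single lookup_partial)
  qed
  then show "A = 0"
    by (subst linear_form_expand [OF assms]) simp
qed (simp add: lookup_apolar)

text \<open>Moving \<open>L^(d-1)\<close> from one side of the product to the other turns the eigenvector equation
  into the statement that the linear form \<open>L^(d-1) \<circ> (F - s L^d)\<close> is killed by all linear \<open>M\<close>.\<close>

lemma eigenvector_with_iff:
  assumes d: "d \<ge> 1" and F: "F \<in> Sym n d" and L: "L \<in> Sym n 1" "L \<noteq> 0"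
  shows "eigenvector_with n d F L s \<longleftrightarrow> L ^ (d - 1) \<in> Ann n (F - const s * L ^ d)"
proof -
  define G where "G = F - const s * L ^ d"
  have G: "G \<in> Sym n d"
    unfolding G_def using F Sym_power [OF L(1), of d] by blast
  have P: "L ^ (d - 1) \<in> Sym n (d - 1)"
    using L by (rule_tac Sym_power)
  have PG: "apolar (L ^ (d - 1)) G \<in> Sym n 1"
    using apolar_in_Sym [OF P, of G 1] G d by simp
  have "bombieri_weyl n d G (L ^ (d - 1) * M) = 0
      \<longleftrightarrow> lookup (apolar M (apolar (L ^ (d - 1)) G)) 0 = 0" if "M \<in> Sym n 1" for M
  proof -
    have "L ^ (d - 1) * M \<in> Sym n d"
      using Sym_mult [OF P that] d by simp
    then have "bombieri_weyl n d G (L ^ (d - 1) * M) = lookup (apolar (M * L ^ (d - 1)) G) 0 / fact d"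
      using G by (simp add: bombieri_weyl_eq apolar_form_def mult.commute)
    then show ?thesis by (simp add: apolar_mult)
  qed
  then have "eigenvector_with n d F L s
      \<longleftrightarrow> (\<forall>M\<in>Sym n 1. lookup (apolar M (apolar (L ^ (d - 1)) G)) 0 = 0)"
    unfolding eigenvector_with_def G_def [symmetric] using L by blast
  also have "\<dots> \<longleftrightarrow> apolar (L ^ (d - 1)) G = 0"
    by (rule linear_form_zero_iff [OF PG, symmetric])
  finally have "eigenvector_with n d F L s \<longleftrightarrow> apolar (L ^ (d - 1)) G = 0" .
  then show ?thesis
    using Sym_subset_poly_ring [OF P] by (simp add: Ann_def G_def)
qed

text \<open>Testing the eigenvector equation on \<open>M = L\<close> gives \<open>\<langle>F, L^d\<rangle> = s \<langle>L, L\<rangle>^d\<close>.  The hypothesis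
  that \<open>L\<close> is not isotropic allows division.\<close>

lemma singular_value_unique:
  assumes d: "d \<ge> 1" and F: "F \<in> Sym n d"
    and "eigenvector_with n d F L s" "eigenvector_with n d F L \<mu>" "lin_inner n L L \<noteq> 0"
  shows "s = \<mu>"
proof -
  have L: "L \<in> Sym n 1"
    using assms by (simp add: eigenvector_with_def)
  have Ld: "L ^ d \<in> Sym n d" and pow: "L ^ (d - 1) * L = L ^ d"
    using Sym_power [OF L] d power_minus_mult [of d L] by auto
  have "apolar_form d F (L ^ d) = t * lin_inner n L L ^ d" if "eigenvector_with n d F L t" for t
  proof -
    have "bombieri_weyl n d (F - const t * L ^ d) (L ^ (d - 1) * L) = 0"
      using that L unfolding eigenvector_with_def by blast
    then have "apolar_form d (F - const t * L ^ d) (L ^ d) = 0"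
      unfolding pow using F Ld by (simp add: bombieri_weyl_eq Sym_diff Sym_scale)
    then have "apolar_form d F (L ^ d) = apolar_form d (const t * L ^ d) (L ^ d)"
      using apolar_form_add(1) [of d "F - const t * L ^ d" "const t * L ^ d" "L ^ d"] by simp
    then show ?thesis
      by (simp add: apolar_form_scale apolar_form_powers [OF L L])
  qed
  from this [OF assms(3)] this [OF assms(4)] show ?thesis
    using assms(5) by simp
qed

theorem lemma3p2:
  fixes n d :: nat and F L :: cpoly
  assumes "n \<ge> 1" and "d \<ge> 2"
    and "F \<in> Sym n d"
    and "L \<in> Sym n 1" and "L \<noteq> 0"
  shows "(proj_point L \<in> Eig n d F \<longleftrightarrow>
            (\<exists>\<mu>. L ^ (d - 1) \<in> Ann n (F - const \<mu> * L ^ d))) \<and>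
         (\<forall>\<mu>. L ^ (d - 1) \<in> Ann n (F - const \<mu> * L ^ d) \<longrightarrow>
            eigenvector_with n d F L \<mu> \<and>
            (lin_inner n L L \<noteq> 0 \<longrightarrow> (\<forall>s. eigenvector_with n d F L s \<longrightarrow> s = \<mu>)))"
proof -
  have d: "d \<ge> 1" using assms(2) by simp
  note iff = eigenvector_with_iff [OF d assms(3)]
  have rep: "\<exists>\<mu>. L ^ (d - 1) \<in> Ann n (F - const \<mu> * L ^ d)" if Eig: "proj_point L \<in> Eig n d F"
  proof -
    obtain L' s where L': "proj_point L = proj_point L'" and ev: "eigenvector_with n d F L' s"
      using Eig by (auto simp: Eig_def)
    have "L' \<in> proj_point L'"
      unfolding proj_point_def by (rule CollectI, rule exI [of _ 1]) simp
    then obtain c where c: "c \<noteq> 0" "L' = const c * L"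
      unfolding L' [symmetric] by (auto simp: proj_point_def)
    have "L' \<in> Sym n 1" "L' \<noteq> 0"
      using ev by (auto simp: eigenvector_with_def)
    with ev have "apolar (L' ^ (d - 1)) (F - const s * L' ^ d) = 0"
      by (simp add: iff Ann_def)
    \<comment> \<open>Passing from \<open>L' = c L\<close> to \<open>L\<close> rescales the singular value to \<open>s c^d\<close>.\<close>
    then have "const (c ^ (d - 1)) * apolar (L ^ (d - 1)) (F - const (s * c ^ d) * L ^ d) = 0"
      by (simp add: c(2) power_mult_distrib const_power [symmetric] apolar_scale_left
          const_mult mult.assoc)
    then have "apolar (L ^ (d - 1)) (F - const (s * c ^ d) * L ^ d) = 0"
      using c(1) by auto
    then show ?thesis
      using Sym_subset_poly_ring [OF Sym_power [OF assms(4)]] by (auto simp: Ann_def)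
  qed
  have "proj_point L \<in> Eig n d F" if "L ^ (d - 1) \<in> Ann n (F - const \<mu> * L ^ d)" for \<mu>
    using that iff [OF assms(4,5)] by (auto simp: Eig_def)
  with rep show ?thesis
    using iff [OF assms(4,5)] singular_value_unique [OF d assms(3)] by blast
qed

end
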